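(* For every $n\ge 3$, the partition $\pi_n$ of $V(\mathcal{Q}(n))$ produced by Algorithm 1 is an equitable partition of $\mathcal{Q}(n)$ with $\frac{(\lceil n/2\rceil+1)\lceil n/2\rceil}{2}$ cells.
   Context: The $n$-Queens' graph $\mathcal{Q}(n)$ has vertex set $[n]^2$ (squares $(i,j)$ of an $n\times n$ chessboard, row $i$ from top, column $j$ from left); two distinct vertices $(i,j),(p,q)$ are adjacent iff $i=p$, or $j=q$, or $i+j=p+q$, or $i-j=p-q$. A partition $V(G)=V_1\dot\cup\cdots\dot\cup V_k$ is equitable if for all $i,j$ every vertex of $V_i$ has the same number of neighbours in $V_j$. Algorithm 1: let $h=\lceil n/2\rceil$; give the squares $(i,j)$ with $1\le i\le j\le h$ pairwise distinct labels $0,1,\dots,\frac{(h+1)h}{2}-1$ (column by column, top to bottom); then extend labels by reflection: first reflect this triangle across the vertical middle line of the board (mapping $(i,j)\mapsto(i,n+1-j)$), then reflect each of the two resulting triangles across its hypotenuse (a diagonal of the board), which labels all squares in the top $h$ rows, then reflect the top $\lfloor n/2\rfloor$ rows across the horizontal middle line ($(i,j)\mapsto(n+1-i,j)$). The cells of $\pi_n$ are the sets of squares with equal labels (equivalently, the orbits of the squares under the symmetry group of the square board generated by these reflections). *)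

theory Defs
  imports Complex_Main "HOL-Library.Disjoint_Sets"
begin

text \<open>A simple graph is a pair of a vertex set and a symmetric, irreflexive adjacency relation on it.\<close>

type_synonym 'a sgraph = "'a set \<times> ('a \<times> 'a) set"

definition is_sgraph :: "'a sgraph \<Rightarrow> bool" where
  "is_sgraph G \<longleftrightarrow> finite (fst G) \<and> snd G \<subseteq> fst G \<times> fst G \<and> sym (snd G) \<and> irrefl (snd G)"

definition neighbours :: "'a sgraph \<Rightarrow> 'a \<Rightarrow> 'a set" where
  "neighbours G v = {w. (v, w) \<in> snd G}"

definition equitable_partition :: "'a sgraph \<Rightarrow> 'a set set \<Rightarrow> bool" where
  "equitable_partition G P \<longleftrightarrow>
     partition_on (fst G) P \<and>
     (\<forall>A\<in>P. \<forall>B\<in>P. \<exists>d. \<forall>v\<in>A. card (neighbours G v \<inter> B) = d)"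

text \<open>
  Squares have integer coordinates (row, column), so that differences such as
  \<open>i - j\<close> and \<open>n + 1 - j\<close> are not truncated.
\<close>

type_synonym square = "int \<times> int"

definition board :: "nat \<Rightarrow> square set" where
  "board n = {1..int n} \<times> {1..int n}"

definition queens_graph :: "nat \<Rightarrow> square sgraph" where
  "queens_graph n = (board n,
     {((i, j), (p, q)) | i j p q.
        (i, j) \<in> board n \<and> (p, q) \<in> board n \<and> (i, j) \<noteq> (p, q) \<and>
        (i = p \<or> j = q \<or> i + j = p + q \<or> i - j = p - q)})"

lemma is_sgraph_queens_graph: "is_sgraph (queens_graph n)"
  unfolding is_sgraph_def queens_graph_def board_def sym_def irrefl_def by auto

definition refl_vert :: "nat \<Rightarrow> square \<Rightarrow> square" where
  "refl_vert n = (\<lambda>(i, j). (i, int n + 1 - j))"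

definition refl_horiz :: "nat \<Rightarrow> square \<Rightarrow> square" where
  "refl_horiz n = (\<lambda>(i, j). (int n + 1 - i, j))"

definition refl_diag :: "square \<Rightarrow> square" where
  "refl_diag = (\<lambda>(i, j). (j, i))"

definition refl_antidiag :: "nat \<Rightarrow> square \<Rightarrow> square" where
  "refl_antidiag n = (\<lambda>(i, j). (int n + 1 - j, int n + 1 - i))"

text \<open>
  Partial labellings of the squares are maps. Each reflection \<open>r\<close> is an involution, so
  \<open>L \<circ> r\<close> is the mirror image of the labelling \<open>L\<close> under \<open>r\<close>.

  In the triangle, labels are assigned column by column, top to bottom: the columns to the left
  of column \<open>j\<close> contain \<open>1 + \<dots> + (j - 1) = j (j - 1) / 2\<close> squares.
\<close>

definition left_triangle :: "nat \<Rightarrow> square \<Rightarrow> nat option" where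
  "left_triangle n = (\<lambda>(i, j).
     if 1 \<le> i \<and> i \<le> j \<and> j \<le> \<lceil>real n / 2\<rceil>
     then Some (nat (j * (j - 1) div 2 + (i - 1))) else None)"

definition right_triangle :: "nat \<Rightarrow> square \<Rightarrow> nat option" where
  "right_triangle n = left_triangle n \<circ> refl_vert n"

text \<open>
  The right operand of \<open>++\<close> takes precedence, so later steps never overwrite a label. The
  hypotenuse of the left triangle lies on the main diagonal, that of the right triangle on the
  antidiagonal.
\<close>

definition top_rows :: "nat \<Rightarrow> square \<Rightarrow> nat option" where
  "top_rows n =
     (right_triangle n \<circ> refl_antidiag n) ++ (left_triangle n \<circ> refl_diag)
       ++ right_triangle n ++ left_triangle n"

definition queens_labelling :: "nat \<Rightarrow> square \<Rightarrow> nat option" where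
  "queens_labelling n =
     ((top_rows n |` {(i, j). i \<le> \<lfloor>real n / 2\<rfloor>}) \<circ> refl_horiz n) ++ top_rows n"

definition queens_partition :: "nat \<Rightarrow> square set set" where
  "queens_partition n =
     (\<lambda>c. {s. queens_labelling n s = Some c}) ` ran (queens_labelling n)"

end

theory Submission
  imports Defs
begin

text \<open>
  Folding each coordinate \<open>i\<close> to \<open>min i (n + 1 - i)\<close> and sorting the two results sends every square
  to its representative in the triangle, and the algorithm labels a square by the number of
  its representative. The representative is reached by successive horizontal, vertical and
  diagonal reflections, each of which is an automorphism of the queens' graph that preserves
  labels. Hence the number of neighbours with a given label depends only on the representative.
\<close>

section \<open>Fibres of a labelling, and neighbour counts under involutions\<close>

lemma partition_on_fibres:
  "partition_on (dom L) ((\<lambda>c. {s. L s = Some c}) ` ran L)"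
  by (rule partition_onI) (auto simp: ran_def disjnt_def)

lemma card_fibres: "card ((\<lambda>c. {s. L s = Some c}) ` ran L) = card (ran L)"
  by (rule card_image, rule inj_onI) (force simp: ran_def set_eq_iff)

text \<open>The map \<open>g\<close> sends neighbours of \<open>g v\<close> in \<open>B\<close> to
  neighbours of \<open>v\<close> in \<open>B\<close> and is its own inverse, so preservation of
  adjacency in one direction suffices.\<close>

lemma card_neighbours_involution:
  assumes inv: "\<And>s. g (g s) = s"
    and adj: "\<And>s t. (s, t) \<in> snd G \<Longrightarrow> (g s, g t) \<in> snd G"
    and B: "\<And>s. g s \<in> B \<longleftrightarrow> s \<in> B"
  shows "card (neighbours G (g v) \<inter> B) = card (neighbours G v \<inter> B)"
proof (rule bij_betw_same_card)
  show "bij_betw g (neighbours G (g v) \<inter> B) (neighbours G v \<inter> B)"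
    by (rule bij_betw_byWitness[where f' = g])
      (use inv adj[of "g v"] adj[of v] B in \<open>auto simp: neighbours_def\<close>)
qed

lemma min_le_max: "min a b \<le> max a b" for a b :: "'a :: linorder"
  by (simp add: min_le_iff_disj)

section \<open>Numbering of the triangle by columns\<close>

definition triangle_label :: "int \<Rightarrow> int \<Rightarrow> nat" where
  "triangle_label i j = nat (j * (j - 1) div 2 + (i - 1))"

text \<open>Column \<open>j\<close> starts at \<open>j * (j - 1) div 2\<close> and holds
  \<open>j\<close> labels, so it is exhausted before column \<open>j + 1\<close> starts.\<close>

lemma triangle_label_less:
  assumes "1 \<le> i" "i \<le> j" "1 \<le> i'" "i' \<le> j'" "j < j'"
  shows "triangle_label i j < triangle_label i' j'"
proof -
  \<comment> \<open>Twice the start of column \<open>j + 1\<close> is compared with twice the start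
    of column \<open>j'\<close>; halving comes last.\<close>
  have "j * (j - 1) + 2 * j = j * (j + 1)"
    by (simp add: algebra_simps)
  also have "\<dots> \<le> j' * (j' - 1)"
    using mult_mono[of j "j' - 1" "j + 1" j'] assms by (simp add: mult.commute)
  finally have "j * (j - 1) div 2 + j \<le> j' * (j' - 1) div 2"
    by linarith
  moreover have "0 \<le> j * (j - 1) div 2"
    using assms by (simp add: pos_imp_zdiv_nonneg_iff)
  ultimately show ?thesis
    using assms unfolding triangle_label_def by linarith
qed

lemma triangle_label_inject:
  assumes "1 \<le> i" "i \<le> j" "1 \<le> i'" "i' \<le> j'" "triangle_label i j = triangle_label i' j'"
  shows "i = i' \<and> j = j'"
proof -
  have "j = j'"
    using triangle_label_less[of i j i' j'] triangle_label_less[of i' j' i j] assms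
    by (cases j j' rule: linorder_cases) auto
  \<comment> \<open>Together with \<open>1 \<le> i\<close> this rules out truncation by
    \<open>nat\<close>, so within a column the label determines the row.\<close>
  moreover have "0 \<le> j * (j - 1) div 2"
    using assms by (simp add: pos_imp_zdiv_nonneg_iff)
  ultimately show ?thesis
    using assms unfolding triangle_label_def by (simp only:) linarith
qed

lemma card_triangle: "2 * card (SIGMA j:{1..int k}. {1..j}) = (k + 1) * k"
proof (induction k)
  case (Suc k)
  have "(SIGMA j:{1..int (Suc k)}. {1..j}) =
      (SIGMA j:{1..int k}. {1..j}) \<union> {int (Suc k)} \<times> {1..int (Suc k)}"
    by auto
  moreover have "card \<dots> = card (SIGMA j:{1..int k}. {1..j}) + card ({int (Suc k)} \<times> {1..int (Suc k)})"
    by (rule card_Un_disjoint) auto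
  ultimately show ?case
    using Suc by (simp add: card_cartesian_product algebra_simps)
qed auto

section \<open>Closed form of the labelling\<close>

definition fold_coord :: "nat \<Rightarrow> int \<Rightarrow> int" where
  "fold_coord n i = min i (int n + 1 - i)"

text \<open>Being total, it is invariant under the reflections without any range conditions.\<close>

definition square_label :: "nat \<Rightarrow> square \<Rightarrow> nat" where
  "square_label n = (\<lambda>(i, j).
     triangle_label (min (fold_coord n i) (fold_coord n j)) (max (fold_coord n i) (fold_coord n j)))"

lemma ceiling_half: "\<lceil>real n / 2\<rceil> = (int n + 1) div 2"
  by (rule ceiling_unique) linarith+

lemma floor_half: "\<lfloor>real n / 2\<rfloor> = int n div 2"
  by (rule floor_unique) linarith+

lemma left_triangle_eq:
  "left_triangle n (i, j) =
     (if 1 \<le> i \<and> i \<le> j \<and> j \<le> (int n + 1) div 2 then Some (triangle_label i j) else None)"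
  by (simp add: left_triangle_def triangle_label_def ceiling_half)

text \<open>Folding and sorting fix the squares of the triangle. With labels in this form, every
  mirror image again carries values of \<open>square_label\<close>.\<close>

lemma left_triangle_eq_square_label:
  "left_triangle n (i, j) =
     (if 1 \<le> i \<and> i \<le> j \<and> j \<le> (int n + 1) div 2 then Some (square_label n (i, j)) else None)"
proof (cases "1 \<le> i \<and> i \<le> j \<and> j \<le> (int n + 1) div 2")
  case True
  then have "fold_coord n i = i" "fold_coord n j = j"
    unfolding fold_coord_def by linarith+
  with True show ?thesis
    by (simp add: left_triangle_eq square_label_def)
qed (auto simp: left_triangle_eq)

lemma fold_coord_mirror [simp]: "fold_coord n (int n + 1 - i) = fold_coord n i"
  by (simp add: fold_coord_def min.commute)

lemma square_label_refl [simp]: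
  "square_label n (refl_horiz n s) = square_label n s"
  "square_label n (refl_vert n s) = square_label n s"
  "square_label n (refl_diag s) = square_label n s"
  by (auto simp: square_label_def refl_horiz_def refl_vert_def refl_diag_def
      min.commute max.commute split: prod.splits)

lemma square_label_mirror [simp]:
  "square_label n (int n + 1 - i, j) = square_label n (i, j)"
  "square_label n (i, int n + 1 - j) = square_label n (i, j)"
  by (simp_all add: square_label_def)

lemma square_label_commute: "square_label n (j, i) = square_label n (i, j)"
  by (simp add: square_label_def min.commute max.commute)

text \<open>The four triangles cover exactly the top half, including any middle row. Where they
  overlap they agree, since each carries values of \<open>square_label\<close>.\<close>

lemma top_rows_eq:
  "top_rows n (i, j) =
     (if 1 \<le> i \<and> i \<le> (int n + 1) div 2 \<and> 1 \<le> j \<and> j \<le> int n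
      then Some (square_label n (i, j)) else None)"
  by (auto simp: top_rows_def map_add_def right_triangle_def refl_vert_def refl_antidiag_def
      refl_diag_def left_triangle_eq_square_label square_label_commute[of n j i])

text \<open>The floor and the ceiling of \<open>n / 2\<close> add up to \<open>n\<close>, so the
  mirrored rows are exactly those below the top half; a middle row is not mirrored.\<close>

lemma queens_labelling_eq:
  "queens_labelling n s = (if s \<in> board n then Some (square_label n s) else None)"
  by (cases s) (auto simp: queens_labelling_def map_add_def refl_horiz_def restrict_map_def
      floor_half top_rows_eq board_def)

lemma dom_queens_labelling: "dom (queens_labelling n) = board n"
  by (auto simp: queens_labelling_eq split: if_splits)

section \<open>Counting the labels\<close>

lemma ran_queens_labelling:
  "ran (queens_labelling n) =
     (\<lambda>(j, i). triangle_label i j) ` (SIGMA j:{1..(int n + 1) div 2}. {1..j})"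
proof (intro set_eqI iffI)
  fix c
  assume "c \<in> ran (queens_labelling n)"
  then obtain i j where "(i, j) \<in> board n" "c = square_label n (i, j)"
    by (auto simp: ran_def queens_labelling_eq split: if_splits)
  then show "c \<in> (\<lambda>(j, i). triangle_label i j) ` (SIGMA j:{1..(int n + 1) div 2}. {1..j})"
    \<comment> \<open>The witness is the representative of the square, written column first because
      the row range depends on the column.\<close>
    by (intro image_eqI[where x = "(max (fold_coord n i) (fold_coord n j),
          min (fold_coord n i) (fold_coord n j))"])
      (auto simp: square_label_def board_def fold_coord_def min_le_max)
next
  fix c
  assume "c \<in> (\<lambda>(j, i). triangle_label i j) ` (SIGMA j:{1..(int n + 1) div 2}. {1..j})"
  then obtain i j where ij: "1 \<le> i" "i \<le> j" "j \<le> (int n + 1) div 2" "c = triangle_label i j"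
    by auto
  then have "fold_coord n i = i" "fold_coord n j = j"
    unfolding fold_coord_def by linarith+
  with ij have "queens_labelling n (i, j) = Some c"
    by (auto simp: queens_labelling_eq square_label_def board_def)
  then show "c \<in> ran (queens_labelling n)"
    by (auto simp: ran_def)
qed

lemma card_ran_queens_labelling:
  "2 * card (ran (queens_labelling n)) = ((n + 1) div 2 + 1) * ((n + 1) div 2)"
proof -
  have "inj_on (\<lambda>(j, i). triangle_label i j) (SIGMA j:{1..(int n + 1) div 2}. {1..j})"
    by (rule inj_onI) (auto dest: triangle_label_inject)
  then show ?thesis
    using card_triangle[of "(n + 1) div 2"]
    by (simp add: ran_queens_labelling card_image zdiv_int add.commute)
qed

section \<open>Reflections as automorphisms of the queens' graph\<close>

lemma card_neighbours_refl:
  fixes n c :: nat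
  defines "B \<equiv> {s. queens_labelling n s = Some c}"
  shows "card (neighbours (queens_graph n) (refl_horiz n v) \<inter> B) =
      card (neighbours (queens_graph n) v \<inter> B)"
    and "card (neighbours (queens_graph n) (refl_vert n v) \<inter> B) =
      card (neighbours (queens_graph n) v \<inter> B)"
    and "card (neighbours (queens_graph n) (refl_diag v) \<inter> B) =
      card (neighbours (queens_graph n) v \<inter> B)"
proof -
  have board: "refl_horiz n s \<in> board n \<longleftrightarrow> s \<in> board n" "refl_vert n s \<in> board n \<longleftrightarrow> s \<in> board n"
    "refl_diag s \<in> board n \<longleftrightarrow> s \<in> board n" for s
    by (auto simp: board_def refl_horiz_def refl_vert_def refl_diag_def split: prod.splits)
  show "card (neighbours (queens_graph n) (refl_horiz n v) \<inter> B) =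
      card (neighbours (queens_graph n) v \<inter> B)"
    \<comment> \<open>The flip exchanges the two diagonal directions. It stays folded in the first
      \<open>auto\<close>, so that \<open>board\<close> and \<open>square_label_refl\<close> settle
      membership in \<open>B\<close>; coordinates serve for the rest.\<close>
    by (rule card_neighbours_involution)
      (auto simp: B_def queens_labelling_eq board, auto simp: refl_horiz_def queens_graph_def board_def)
  show "card (neighbours (queens_graph n) (refl_vert n v) \<inter> B) =
      card (neighbours (queens_graph n) v \<inter> B)"
    by (rule card_neighbours_involution)
      (auto simp: B_def queens_labelling_eq board, auto simp: refl_vert_def queens_graph_def board_def)
  show "card (neighbours (queens_graph n) (refl_diag v) \<inter> B) =
      card (neighbours (queens_graph n) v \<inter> B)"
    by (rule card_neighbours_involution)
      (auto simp: B_def queens_labelling_eq board, auto simp: refl_diag_def queens_graph_def board_def)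
qed

lemma card_neighbours_representative:
  fixes n c :: nat
  defines "B \<equiv> {s. queens_labelling n s = Some c}"
  shows "card (neighbours (queens_graph n) (i, j) \<inter> B) =
    card (neighbours (queens_graph n)
      (min (fold_coord n i) (fold_coord n j), max (fold_coord n i) (fold_coord n j)) \<inter> B)"
proof -
  let ?d = "\<lambda>s. card (neighbours (queens_graph n) s \<inter> B)"
  \<comment> \<open>Folding either leaves the row alone or performs the horizontal flip; likewise
    for columns and for sorting.\<close>
  have "?d (i, j) = ?d (fold_coord n i, j)" for i j
    using card_neighbours_refl(1)[of n "(i, j)" c]
    by (auto simp: fold_coord_def min_def refl_horiz_def B_def)
  moreover have "?d (i, j) = ?d (i, fold_coord n j)" for i j
    using card_neighbours_refl(2)[of n "(i, j)" c]
    by (auto simp: fold_coord_def min_def refl_vert_def B_def)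
  moreover have "?d (i, j) = ?d (min i j, max i j)" for i j
    using card_neighbours_refl(3)[of n "(i, j)" c]
    by (auto simp: min_def max_def refl_diag_def B_def)
  ultimately show ?thesis
    by metis
qed

text \<open>For squares on the board, the folded and sorted pairs satisfy the bounds under which
  labels are injective, so equal labels mean a common representative.\<close>

lemma card_neighbours_same_label:
  assumes "v \<in> board n" "w \<in> board n" "square_label n v = square_label n w"
  shows "card (neighbours (queens_graph n) v \<inter> {s. queens_labelling n s = Some c}) =
    card (neighbours (queens_graph n) w \<inter> {s. queens_labelling n s = Some c})"
proof -
  obtain i j p q where vw: "v = (i, j)" "w = (p, q)"
    by (cases v, cases w)
  have "min (fold_coord n i) (fold_coord n j) = min (fold_coord n p) (fold_coord n q) \<and>
      max (fold_coord n i) (fold_coord n j) = max (fold_coord n p) (fold_coord n q)"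
    by (rule triangle_label_inject)
      (use assms in \<open>auto simp: vw board_def square_label_def fold_coord_def min_le_max\<close>)
  then show ?thesis
    using card_neighbours_representative[of n i j c] card_neighbours_representative[of n p q c]
    by (simp add: vw)
qed

theorem theorem12:
  fixes n :: nat
  assumes "n \<ge> 3"
  shows "equitable_partition (queens_graph n) (queens_partition n) \<and>
    real (card (queens_partition n)) =
      (of_int \<lceil>real n / 2\<rceil> + 1) * of_int \<lceil>real n / 2\<rceil> / 2"
proof
  have "\<exists>d. \<forall>v\<in>A. card (neighbours (queens_graph n) v \<inter> B) = d"
    if cells: "A \<in> queens_partition n" "B \<in> queens_partition n" for A B
  proof -
    obtain a b where A: "A = {s. queens_labelling n s = Some a}"
      and B: "B = {s. queens_labelling n s = Some b}"
      using cells by (auto simp: queens_partition_def)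
    have "card (neighbours (queens_graph n) v \<inter> B) = card (neighbours (queens_graph n) w \<inter> B)"
      if "v \<in> A" "w \<in> A" for v w
      unfolding B by (rule card_neighbours_same_label)
        (use that in \<open>auto simp: A queens_labelling_eq split: if_splits\<close>)
    then show ?thesis
      by metis
  qed
  moreover have "partition_on (fst (queens_graph n)) (queens_partition n)"
    using partition_on_fibres[of "queens_labelling n"]
    by (simp add: queens_partition_def queens_graph_def dom_queens_labelling)
  ultimately show "equitable_partition (queens_graph n) (queens_partition n)"
    by (auto simp: equitable_partition_def)
next
  have "2 * real (card (queens_partition n)) =
      (real ((n + 1) div 2) + 1) * real ((n + 1) div 2)"
    unfolding queens_partition_def card_fibres
    using arg_cong[OF card_ran_queens_labelling[of n], of real] by (simp add: algebra_simps)
  moreover have "\<lceil>real n / 2\<rceil> = int ((n + 1) div 2)"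
    unfolding ceiling_half by linarith
  ultimately show "real (card (queens_partition n)) =
      (of_int \<lceil>real n / 2\<rceil> + 1) * of_int \<lceil>real n / 2\<rceil> / 2"
    by simp
qed

end
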